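(* Let $n\ge1$, $0=b_0<b_1<\cdots<b_n<b_{n+1}=1$, $\mathbf c=(c_0,\dots,c_n)^T\in\mathbb R^{n+1}$, $\alpha\in\mathbb R$, $\gamma>0$, and let $a,r,f$ be real-valued functions on $I=(0,1)$ with $a,r\in L^\infty(I)$, $a\ge a_0>0$ and $r\ge r_0\ge 0$ a.e. on $I$ for constants $a_0,r_0$. Let $\tilde h_i=\min\{h_{i-1},h_i\}$. If for all $i=1,\dots,n$ one has $c_i\ne0$, $a$ is differentiable at $b_i$, and $$\frac{g_i}{c_i}+\frac{r_0\tilde h_i}{4}>0,$$ then the matrix $$\mathbf H(\mathbf c,\mathbf b)=\mathbf D(\hat{\mathbf c})\left(\mathbf D(\mathbf g)+A_r(\mathbf b)\mathbf D(\hat{\mathbf c})+\gamma\,\mathbf 1\hat{\mathbf c}^T\right)$$ is invertible.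
   Context: $\sigma(t)=\max\{0,t\}$; $H$ is the Heaviside function ($H(t)=1$ for $t>0$, $H(0)=\tfrac12$, $H(t)=0$ for $t<0$); $\mathbf b=(b_1,\dots,b_n)^T$; $h_i=b_{i+1}-b_i$ for $i=0,\dots,n$. Let $u_n(x)=\alpha+c_0x+\sum_{i=1}^n c_i\sigma(x-b_i)$, and set $u_n'(b_i):=\sum_{l=0}^{i-1}c_l+\frac{c_i}{2}$. For $i=1,\dots,n$ define $g_i=r(b_i)u_n(b_i)-f(b_i)-a'(b_i)u_n'(b_i)$. Then $\mathbf D(\mathbf g)=\mathrm{diag}(g_1,\dots,g_n)$, $\hat{\mathbf c}=(c_1,\dots,c_n)^T$, $\mathbf D(\hat{\mathbf c})=\mathrm{diag}(c_1,\dots,c_n)$, $\mathbf 1=(1,\dots,1)^T\in\mathbb R^n$, and $A_r(\mathbf b)$ is the $n\times n$ matrix with entries $\int_0^1 r(x)H(x-b_i)H(x-b_j)\,dx$, $i,j=1,\dots,n$. (In the paper $\mathbf H(\mathbf c,\mathbf b)$ is the Hessian with respect to $\mathbf b$ of the modified Ritz energy $J(u_n)=\frac12\int_0^1 a(u_n')^2+\frac12\int_0^1 r u_n^2-\int_0^1 f u_n+\frac\gamma2(u_n(1)-\beta)^2$.) *)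

theory Defs
  imports "HOL-Analysis.Analysis" "Jordan_Normal_Form.Matrix"
begin

text \<open>
  Breakpoints \<open>b 0, \<dots>, b (n+1)\<close> and coefficients \<open>c 0, \<dots>, c n\<close> are sequences, of which only
  these entries are used.  Matrices and vectors are indexed from 0, so that entry \<open>i\<close> belongs to
  the interior breakpoint \<open>b (Suc i)\<close>.  Functions on \<open>(0,1)\<close> are total functions of which only
  the values on \<open>(0,1)\<close> are used.
\<close>

abbreviation I01 :: "real set" where
  "I01 \<equiv> {0<..<1}"

definition L_infinity :: "real set \<Rightarrow> (real \<Rightarrow> real) \<Rightarrow> bool" where
  "L_infinity S f \<longleftrightarrow>
     f \<in> borel_measurable (lebesgue_on S) \<and> (\<exists>C. AE x in lebesgue_on S. \<bar>f x\<bar> \<le> C)"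

definition relu :: "real \<Rightarrow> real" where
  "relu t = max 0 t"

definition heaviside :: "real \<Rightarrow> real" where
  "heaviside t = (if t > 0 then 1 else if t = 0 then 1/2 else 0)"

definition mesh_width :: "(nat \<Rightarrow> real) \<Rightarrow> nat \<Rightarrow> real" where
  "mesh_width b i = b (Suc i) - b i"

definition min_mesh_width :: "(nat \<Rightarrow> real) \<Rightarrow> nat \<Rightarrow> real" where
  "min_mesh_width b i = min (mesh_width b (i - 1)) (mesh_width b i)"

definition relu_net ::
    "nat \<Rightarrow> real \<Rightarrow> (nat \<Rightarrow> real) \<Rightarrow> (nat \<Rightarrow> real) \<Rightarrow> real \<Rightarrow> real" where
  "relu_net n \<alpha> c b x = \<alpha> + c 0 * x + (\<Sum>i=1..n. c i * relu (x - b i))"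

text \<open>The convention for \<open>u\<^sub>n'(b\<^sub>i)\<close>, where \<open>u\<^sub>n\<close> has a kink: the mean of the one-sided slopes.\<close>

definition relu_net_slope :: "(nat \<Rightarrow> real) \<Rightarrow> nat \<Rightarrow> real" where
  "relu_net_slope c i = (\<Sum>l<i. c l) + c i / 2"

definition g_coeff ::
    "nat \<Rightarrow> (real \<Rightarrow> real) \<Rightarrow> (real \<Rightarrow> real) \<Rightarrow> (real \<Rightarrow> real) \<Rightarrow>
     real \<Rightarrow> (nat \<Rightarrow> real) \<Rightarrow> (nat \<Rightarrow> real) \<Rightarrow> nat \<Rightarrow> real" where
  "g_coeff n a r f \<alpha> c b i =
     r (b i) * relu_net n \<alpha> c b (b i) - f (b i) - deriv a (b i) * relu_net_slope c i"

definition D_mat :: "nat \<Rightarrow> (nat \<Rightarrow> real) \<Rightarrow> real mat" where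
  "D_mat n v = mat_diag n (\<lambda>i. v (Suc i))"

definition A_mat :: "nat \<Rightarrow> (real \<Rightarrow> real) \<Rightarrow> (nat \<Rightarrow> real) \<Rightarrow> real mat" where
  "A_mat n r b = Matrix.mat n n (\<lambda>(i, j).
     LINT x|lebesgue_on I01. r x * heaviside (x - b (Suc i)) * heaviside (x - b (Suc j)))"

text \<open>The rank-one matrix \<open>\<one> v\<^sup>T\<close>, a column times a row.\<close>

definition ones_outer :: "nat \<Rightarrow> (nat \<Rightarrow> real) \<Rightarrow> real mat" where
  "ones_outer n v =
     mat_of_cols n [Matrix.vec n (\<lambda>_. 1)] * mat_of_rows n [Matrix.vec n (\<lambda>i. v (Suc i))]"

definition H_mat ::
    "nat \<Rightarrow> (real \<Rightarrow> real) \<Rightarrow> (real \<Rightarrow> real) \<Rightarrow> (real \<Rightarrow> real) \<Rightarrow> real \<Rightarrow>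
     real \<Rightarrow> (nat \<Rightarrow> real) \<Rightarrow> (nat \<Rightarrow> real) \<Rightarrow> real mat" where
  "H_mat n a r f \<gamma> \<alpha> c b =
     D_mat n c *
       (D_mat n (g_coeff n a r f \<alpha> c b) + A_mat n r b * D_mat n c + \<gamma> \<cdot>\<^sub>m ones_outer n c)"

end

theory Submission
  imports Defs "Jordan_Normal_Form.Determinant"
begin

unbundle no vec_syntax

text \<open>
  With \<open>\<eta> = D(c) \<xi>\<close>, a kernel vector \<open>\<xi>\<close> of \<open>H\<close> satisfies \<open>(D(g/c) + A\<^sub>r + \<gamma> \<one>\<one>\<^sup>T) \<eta> = 0\<close>, so it
  suffices that this symmetric matrix is positive definite.  Its middle part has the quadratic form
  \<open>\<integral> r v\<^sup>2 \<ge> r\<^sub>0 \<integral> v\<^sup>2\<close> where \<open>v = \<Sum>\<^sub>i \<eta>\<^sub>i H(\<cdot> - b\<^sub>i)\<close> is a step function whose value on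
  \<open>(b\<^sub>k, b\<^sub>k\<^sub>+\<^sub>1)\<close> is the partial sum \<open>s\<^sub>k\<close> of \<open>\<eta>\<close>.  Since \<open>\<eta>\<^sub>k\<close> is the jump \<open>s\<^sub>k - s\<^sub>k\<^sub>-\<^sub>1\<close>, we have
  \<open>\<eta>\<^sub>k\<^sup>2 \<le> 2 s\<^sub>k\<^sup>2 + 2 s\<^sub>k\<^sub>-\<^sub>1\<^sup>2\<close>; weighting by the smaller neighbouring mesh width and summing gives
  \<open>\<integral> v\<^sup>2 \<ge> 1/4 \<Sum>\<^sub>k min(h\<^sub>k\<^sub>-\<^sub>1, h\<^sub>k) \<eta>\<^sub>k\<^sup>2\<close>.
\<close>

section \<open>Linear algebra: trivial kernel and the entries of \<open>H_mat\<close>\<close>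

lemma invertible_mat_if_trivial_kernel:
  fixes A :: "'a :: field mat"
  assumes A: "A \<in> carrier_mat n n"
    and ker: "\<And>v. v \<in> carrier_vec n \<Longrightarrow> A *\<^sub>v v = 0\<^sub>v n \<Longrightarrow> v = 0\<^sub>v n"
  shows "invertible_mat A"
proof -
  have "Determinant.det A \<noteq> 0"
    using det_0_iff_vec_prod_zero_field[OF A] ker by blast
  then have "A \<in> Units (ring_mat TYPE('a) n ())"
    by (rule det_non_zero_imp_unit[OF A])
  then show ?thesis
    using A unfolding Units_def invertible_mat_def inverts_mat_def
    by (auto simp: ring_mat_simps)
qed

lemma A_mat_carrier [simp]: "A_mat n r b \<in> carrier_mat n n"
  by (simp add: A_mat_def)

lemma ones_outer_eq: "ones_outer n v = Matrix.mat n n (\<lambda>(i, j). v (Suc j))"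
  by (rule eq_matI) (auto simp: ones_outer_def scalar_prod_def mat_of_cols_def mat_of_rows_def)

lemma H_mat_eq:
  "H_mat n a r f \<gamma> \<alpha> c b = Matrix.mat n n (\<lambda>(i, j). c (Suc i) *
     ((if i = j then g_coeff n a r f \<alpha> c b (Suc i) else 0)
       + A_mat n r b $$ (i, j) * c (Suc j) + \<gamma> * c (Suc j)))"
proof -
  have A: "A_mat n r b * D_mat n c = Matrix.mat n n (\<lambda>(i, j). A_mat n r b $$ (i, j) * c (Suc j))"
    unfolding D_mat_def by (rule mat_diag_mult_right) simp
  show ?thesis
    unfolding H_mat_def A ones_outer_eq unfolding D_mat_def
    by (subst mat_diag_mult_left[of _ n n]) (auto simp: mat_diag_def)
qed

text \<open>The products \<open>c (Suc j) * v $ j\<close> are kept together because they are the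
  entries of the substituted vector D(c) v; the common factor \<open>c (Suc i)\<close> can later be
  cancelled row by row.\<close>

lemma H_mat_mult_vec:
  assumes "v \<in> carrier_vec n" and "i < n"
  shows "(H_mat n a r f \<gamma> \<alpha> c b *\<^sub>v v) $ i = c (Suc i) *
    (g_coeff n a r f \<alpha> c b (Suc i) * v $ i
      + (\<Sum>j<n. A_mat n r b $$ (i, j) * (c (Suc j) * v $ j)) + \<gamma> * (\<Sum>j<n. c (Suc j) * v $ j))"
proof -
  have "(H_mat n a r f \<gamma> \<alpha> c b *\<^sub>v v) $ i = (\<Sum>j<n. c (Suc i) *
     ((if i = j then g_coeff n a r f \<alpha> c b (Suc i) else 0)
       + A_mat n r b $$ (i, j) * c (Suc j) + \<gamma> * c (Suc j)) * v $ j)"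
    using assms by (simp add: H_mat_eq scalar_prod_def lessThan_atLeast0)
  also have "\<dots> = (\<Sum>j<n. c (Suc i) *
     ((if i = j then g_coeff n a r f \<alpha> c b (Suc i) * v $ j else 0)
       + A_mat n r b $$ (i, j) * (c (Suc j) * v $ j) + \<gamma> * (c (Suc j) * v $ j)))"
    by (rule sum.cong) (auto simp: algebra_simps)
  also have "\<dots> = c (Suc i) *
    (g_coeff n a r f \<alpha> c b (Suc i) * v $ i
      + (\<Sum>j<n. A_mat n r b $$ (i, j) * (c (Suc j) * v $ j)) + \<gamma> * (\<Sum>j<n. c (Suc j) * v $ j))"
    using assms(2) by (simp add: sum_distrib_left[symmetric] sum.distrib)
  finally show ?thesis .
qed

section \<open>Jumps and step functions on the mesh\<close>

lemma sum_min_mult_diff_square_le: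
  fixes h s :: "nat \<Rightarrow> real"
  assumes "\<And>k. k \<le> n \<Longrightarrow> 0 \<le> h k"
  shows "(\<Sum>k<n. min (h k) (h (Suc k)) * (s (Suc k) - s k)\<^sup>2) \<le> 4 * (\<Sum>k\<le>n. h k * (s k)\<^sup>2)"
proof -
  have "(\<Sum>k<n. min (h k) (h (Suc k)) * (s (Suc k) - s k)\<^sup>2)
      \<le> (\<Sum>k<n. 2 * (h k * (s k)\<^sup>2) + 2 * (h (Suc k) * (s (Suc k))\<^sup>2))"
  proof (rule sum_mono)
    fix k assume "k \<in> {..<n}"
    then have m: "0 \<le> min (h k) (h (Suc k))"
      using assms by simp
    \<comment> \<open>The square of the sum is exactly the gap in (p - q)^2 \<le> 2 p^2 + 2
      q^2.\<close>
    have "0 \<le> (s (Suc k) + s k)\<^sup>2"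
      by simp
    then have "(s (Suc k) - s k)\<^sup>2 \<le> 2 * (s k)\<^sup>2 + 2 * (s (Suc k))\<^sup>2"
      by (simp add: power2_eq_square algebra_simps)
    then have "min (h k) (h (Suc k)) * (s (Suc k) - s k)\<^sup>2
        \<le> min (h k) (h (Suc k)) * (2 * (s k)\<^sup>2 + 2 * (s (Suc k))\<^sup>2)"
      using m by (rule mult_left_mono)
    also have "\<dots> = 2 * (min (h k) (h (Suc k)) * (s k)\<^sup>2)
        + 2 * (min (h k) (h (Suc k)) * (s (Suc k))\<^sup>2)"
      by (simp add: algebra_simps)
    also have "\<dots> \<le> 2 * (h k * (s k)\<^sup>2) + 2 * (h (Suc k) * (s (Suc k))\<^sup>2)"
      by (intro add_mono mult_left_mono mult_right_mono) auto
    finally show "min (h k) (h (Suc k)) * (s (Suc k) - s k)\<^sup>2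
        \<le> 2 * (h k * (s k)\<^sup>2) + 2 * (h (Suc k) * (s (Suc k))\<^sup>2)" .
  qed
  also have "\<dots> = 2 * (\<Sum>k<n. h k * (s k)\<^sup>2) + 2 * (\<Sum>k<n. h (Suc k) * (s (Suc k))\<^sup>2)"
    by (simp add: sum.distrib sum_distrib_left)
  \<comment> \<open>Each inner index occurs in both sums, which produces the constant 4; the indices
    0 and n occur only once, so a nonnegative term is missing at either end.\<close>
  also have "\<dots> = 4 * (\<Sum>k\<le>n. h k * (s k)\<^sup>2) - 2 * (h n * (s n)\<^sup>2) - 2 * (h 0 * (s 0)\<^sup>2)"
    using sum.lessThan_Suc[of "\<lambda>k. h k * (s k)\<^sup>2" n]
      sum.lessThan_Suc_shift[of "\<lambda>k. h k * (s k)\<^sup>2" n]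
    by (simp add: lessThan_Suc_atMost)
  also have "\<dots> \<le> 4 * (\<Sum>k\<le>n. h k * (s k)\<^sup>2)"
    using mult_nonneg_nonneg[OF assms[of 0], of "(s 0)\<^sup>2"]
      mult_nonneg_nonneg[OF assms[of n], of "(s n)\<^sup>2"] by simp
  finally show ?thesis .
qed

text \<open>The breakpoints \<open>b (Suc i)\<close> to the left of the open cell number k are those
  with \<open>i < k\<close>. As x lies strictly inside the cell, the value 1/2 of
  \<open>heaviside\<close> at 0 never occurs.\<close>

lemma sum_heaviside_eq_partial_sum:
  fixes b \<eta> :: "nat \<Rightarrow> real"
  assumes mono: "\<And>i j. i \<le> j \<Longrightarrow> j \<le> Suc n \<Longrightarrow> b i \<le> b j"
    and "k \<le> n" and x: "x \<in> {b k<..<b (Suc k)}"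
  shows "(\<Sum>i<n. \<eta> i * heaviside (x - b (Suc i))) = (\<Sum>i<k. \<eta> i)"
proof -
  have "(\<Sum>i<k. \<eta> i) = (\<Sum>i<n. if i < k then \<eta> i else 0)"
    using \<open>k \<le> n\<close> by (intro sum.mono_neutral_cong_left) auto
  also have "\<dots> = (\<Sum>i<n. \<eta> i * heaviside (x - b (Suc i)))"
  proof (rule sum.cong)
    fix i assume "i \<in> {..<n}"
    then show "(if i < k then \<eta> i else 0) = \<eta> i * heaviside (x - b (Suc i))"
      using mono[of "Suc i" k] mono[of "Suc k" "Suc i"] \<open>k \<le> n\<close> x
      by (cases "i < k") (auto simp: heaviside_def)
  qed simp
  finally show ?thesis by simp
qed

text \<open>The open cells are pairwise disjoint, so at most one summand survives; where none does,
  for instance at a breakpoint, the sum is 0 and \<open>0 \<le> y\<close> settles it.\<close>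

lemma sum_indicator_between_le:
  fixes b F :: "nat \<Rightarrow> real"
  assumes mono: "\<And>i j. i \<le> j \<Longrightarrow> j \<le> Suc n \<Longrightarrow> b i \<le> b j"
    and le: "\<And>k. k \<le> n \<Longrightarrow> x \<in> {b k<..<b (Suc k)} \<Longrightarrow> F k \<le> y" and "0 \<le> y"
  shows "(\<Sum>k\<le>n. F k * indicator {b k<..<b (Suc k)} x) \<le> y"
proof (cases "\<exists>k\<le>n. x \<in> {b k<..<b (Suc k)}")
  case True
  then obtain k where k: "k \<le> n" "x \<in> {b k<..<b (Suc k)}" by blast
  have "x \<notin> {b j<..<b (Suc j)}" if "j \<le> n" "j \<noteq> k" for j
    using mono[of "Suc j" k] mono[of "Suc k" j] that k by (cases j k rule: linorder_cases) auto
  then have "(\<Sum>j\<le>n. F j * indicator {b j<..<b (Suc j)} x) = (\<Sum>j\<in>{k}. F j)"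
    using k by (intro sum.mono_neutral_cong_right) (auto simp: indicator_def)
  then show ?thesis using le k by simp
next
  case False
  then have "(\<Sum>k\<le>n. F k * indicator {b k<..<b (Suc k)} x) = 0"
    by (intro sum.neutral) (auto simp: indicator_def)
  then show ?thesis using \<open>0 \<le> y\<close> by simp
qed

section \<open>Integrals over the unit interval and the quadratic form of
  \<open>A_mat\<close>\<close>

lemma borel_measurable_lebesgue_on_if_borel:
  "f \<in> borel_measurable borel \<Longrightarrow> f \<in> borel_measurable (lebesgue_on S)"
  by (simp add: measurable_completion measurable_restrict_space1)

lemma borel_measurable_heaviside [measurable]: "heaviside \<in> borel_measurable borel"
  unfolding heaviside_def[abs_def] by measurable

lemma abs_heaviside_le: "\<bar>heaviside t\<bar> \<le> 1"
  by (simp add: heaviside_def)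

text \<open>The product is measurable and almost everywhere bounded by a constant, which suffices on
  a set of finite measure.\<close>

lemma integrable_L_infinity_mult:
  assumes r: "L_infinity S r" and S: "S \<in> lmeasurable"
    and v: "v \<in> borel_measurable borel" and bound: "\<And>x. \<bar>v x\<bar> \<le> B"
  shows "integrable (lebesgue_on S) (\<lambda>x. r x * v x)"
proof -
  interpret finite_measure "lebesgue_on S"
    using S by (rule finite_measure_lebesgue_on)
  obtain C where C: "AE x in lebesgue_on S. \<bar>r x\<bar> \<le> C"
    using r unfolding L_infinity_def by blast
  show ?thesis
  proof (rule integrable_const_bound)
    show "AE x in lebesgue_on S. norm (r x * v x) \<le> C * B"
      using C by eventually_elim (auto simp: abs_mult intro!: mult_mono bound)
    show "(\<lambda>x. r x * v x) \<in> borel_measurable (lebesgue_on S)"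
      using r borel_measurable_lebesgue_on_if_borel[OF v]
      unfolding L_infinity_def by (intro borel_measurable_times) auto
  qed
qed

lemma A_mat_quadratic_form:
  assumes r: "L_infinity I01 r"
  shows "(\<Sum>i<n. \<Sum>j<n. \<eta> i * (A_mat n r b $$ (i, j) * \<eta> j))
    = (LINT x|lebesgue_on I01. r x * (\<Sum>i<n. \<eta> i * heaviside (x - b (Suc i)))\<^sup>2)"
proof -
  have int: "integrable (lebesgue_on I01)
      (\<lambda>x. r x * heaviside (x - b (Suc i)) * heaviside (x - b (Suc j)))" for i j
    unfolding mult.assoc
    by (rule integrable_L_infinity_mult[OF r, where B = 1])
      (auto simp: abs_mult intro!: mult_le_one abs_heaviside_le)
  have "(LINT x|lebesgue_on I01. r x * (\<Sum>i<n. \<eta> i * heaviside (x - b (Suc i)))\<^sup>2)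
      = (LINT x|lebesgue_on I01. (\<Sum>i<n. \<Sum>j<n. (\<eta> i * \<eta> j) *
          (r x * heaviside (x - b (Suc i)) * heaviside (x - b (Suc j)))))"
    unfolding power2_eq_square sum_product by (simp add: sum_distrib_left ac_simps)
  also have "\<dots> = (\<Sum>i<n. \<Sum>j<n. (\<eta> i * \<eta> j) *
      (LINT x|lebesgue_on I01. r x * heaviside (x - b (Suc i)) * heaviside (x - b (Suc j))))"
    using int by (simp add: Bochner_Integration.integral_sum)
  also have "\<dots> = (\<Sum>i<n. \<Sum>j<n. \<eta> i * (A_mat n r b $$ (i, j) * \<eta> j))"
    by (intro sum.cong) (auto simp: A_mat_def)
  finally show ?thesis by simp
qed

lemma A_mat_quadratic_form_ge:
  fixes b \<eta> :: "nat \<Rightarrow> real"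
  assumes r: "L_infinity I01 r" and r0: "0 \<le> r0" and ge: "AE x in lebesgue_on I01. r0 \<le> r x"
    and b0: "b 0 = 0" and bn: "b (Suc n) = 1" and step: "\<And>i. i \<le> n \<Longrightarrow> b i \<le> b (Suc i)"
  shows "r0 / 4 * (\<Sum>i<n. min_mesh_width b (Suc i) * (\<eta> i)\<^sup>2)
    \<le> (\<Sum>i<n. \<Sum>j<n. \<eta> i * (A_mat n r b $$ (i, j) * \<eta> j))"
proof -
  define s where "s k = (\<Sum>i<k. \<eta> i)" for k
  define v where "v x = (\<Sum>i<n. \<eta> i * heaviside (x - b (Suc i)))" for x
  \<comment> \<open>Inside the cells \<open>w\<close> agrees with the square of \<open>v\<close>,
    and at the breakpoints it is 0. It thus lies below that square everywhere, while its integral is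
    a finite sum of cell widths.\<close>
  define w where "w x = (\<Sum>k\<le>n. (s k)\<^sup>2 * indicator {b k<..<b (Suc k)} x)" for x :: real
  interpret finite_measure "lebesgue_on I01"
    by (rule finite_measure_lebesgue_on) simp
  have mono: "b i \<le> b j" if "i \<le> j" "j \<le> Suc n" for i j
    using that by (induction j rule: dec_induct) (auto intro: order_trans step)
  have v_meas: "v \<in> borel_measurable borel"
    unfolding v_def[abs_def] by measurable
  have v_bound: "\<bar>(v x)\<^sup>2\<bar> \<le> (\<Sum>i<n. \<bar>\<eta> i\<bar>)\<^sup>2" for x
  proof -
    have "\<bar>v x\<bar> \<le> (\<Sum>i<n. \<bar>\<eta> i\<bar>)"
      unfolding v_def
      by (rule order_trans[OF sum_abs])
        (auto simp: abs_mult intro!: sum_mono mult_left_le abs_heaviside_le)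
    then have "\<bar>v x\<bar>\<^sup>2 \<le> (\<Sum>i<n. \<bar>\<eta> i\<bar>)\<^sup>2"
      by (rule power_mono) simp
    then show ?thesis by simp
  qed
  have "v x = s k" if "k \<le> n" "x \<in> {b k<..<b (Suc k)}" for k x
    unfolding v_def s_def by (rule sum_heaviside_eq_partial_sum[OF mono that])
  then have w_le: "w x \<le> (v x)\<^sup>2" for x
    unfolding w_def by (intro sum_indicator_between_le[OF mono]) auto
  have ind: "integrable (lebesgue_on I01) (indicator {b k<..<b (Suc k)} :: real \<Rightarrow> real)"
    "(LINT x|lebesgue_on I01. indicator {b k<..<b (Suc k)} x) = mesh_width b k" if "k \<le> n" for k
  proof -
    \<comment> \<open>Each cell lies in the unit interval, so restricting Lebesgue measure leaves
      its length unchanged.\<close>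
    have sub: "{b k<..<b (Suc k)} \<subseteq> I01"
      using mono[of 0 k] mono[of "Suc k" "Suc n"] b0 bn that by auto
    have sets: "{b k<..<b (Suc k)} \<in> sets (lebesgue_on I01)"
      using sub by (auto simp: sets_restrict_space_iff)
    have "measure (lebesgue_on I01) {b k<..<b (Suc k)} = mesh_width b k"
      using sub step[OF that] by (simp add: measure_restrict_space mesh_width_def)
    then show "(LINT x|lebesgue_on I01. indicator {b k<..<b (Suc k)} x) = mesh_width b k"
      by (simp only: Bochner_Integration.integral_indicator space_lebesgue_on Int_absorb2[OF sub])
    show "integrable (lebesgue_on I01) (indicator {b k<..<b (Suc k)} :: real \<Rightarrow> real)"
      using sets by (simp add: emeasure_eq_measure)
  qed
  have w_int: "integrable (lebesgue_on I01) w"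
    unfolding w_def[abs_def] by (intro Bochner_Integration.integrable_sum integrable_mult_right ind) simp
  \<comment> \<open>The entry \<open>\<eta> k\<close> is the jump of \<open>v\<close> at
    \<open>b (Suc k)\<close>, between the cells k and \<open>Suc k\<close>, whose widths are the two
    that \<open>min_mesh_width b (Suc k)\<close> compares.\<close>
  have "(\<Sum>k<n. min_mesh_width b (Suc k) * (\<eta> k)\<^sup>2)
      = (\<Sum>k<n. min (mesh_width b k) (mesh_width b (Suc k)) * (s (Suc k) - s k)\<^sup>2)"
    by (simp add: min_mesh_width_def s_def)
  also have "\<dots> \<le> 4 * (\<Sum>k\<le>n. mesh_width b k * (s k)\<^sup>2)"
    by (rule sum_min_mult_diff_square_le) (simp add: mesh_width_def step)
  also have "(\<Sum>k\<le>n. mesh_width b k * (s k)\<^sup>2) = (LINT x|lebesgue_on I01. w x)"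
  proof -
    have "(LINT x|lebesgue_on I01. w x)
        = (\<Sum>k\<le>n. LINT x|lebesgue_on I01. (s k)\<^sup>2 * indicator {b k<..<b (Suc k)} x)"
      unfolding w_def
      by (intro Bochner_Integration.integral_sum integrable_mult_right ind) simp
    also have "\<dots> = (\<Sum>k\<le>n. (s k)\<^sup>2 * mesh_width b k)"
      by (rule sum.cong) (simp_all only: Bochner_Integration.integral_mult_right_zero ind atMost_iff)
    finally show ?thesis by (simp add: mult.commute)
  qed
  finally have "r0 / 4 * (\<Sum>k<n. min_mesh_width b (Suc k) * (\<eta> k)\<^sup>2)
      \<le> r0 / 4 * (4 * (LINT x|lebesgue_on I01. w x))"
    using r0 by (intro mult_left_mono) auto
  also have "\<dots> = (LINT x|lebesgue_on I01. r0 * w x)"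
    by simp
  also have "\<dots> \<le> (LINT x|lebesgue_on I01. r x * (v x)\<^sup>2)"
  proof (rule integral_mono_AE)
    show "integrable (lebesgue_on I01) (\<lambda>x. r0 * w x)"
      using w_int by simp
    show "integrable (lebesgue_on I01) (\<lambda>x. r x * (v x)\<^sup>2)"
      using v_meas by (intro integrable_L_infinity_mult[OF r _ _ v_bound]) auto
    show "AE x in lebesgue_on I01. r0 * w x \<le> r x * (v x)\<^sup>2"
      using ge
    proof eventually_elim
      case (elim x)
      \<comment> \<open>Passing from \<open>w\<close> to the square of \<open>v\<close> uses
        \<open>0 \<le> r0\<close>; only then is \<open>r0\<close> replaced by \<open>r x\<close>,
        against a nonnegative factor.\<close>
      have "r0 * w x \<le> r0 * (v x)\<^sup>2"
        using w_le r0 by (rule mult_left_mono)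
      also have "\<dots> \<le> r x * (v x)\<^sup>2"
        using elim by (rule mult_right_mono) simp
      finally show ?case .
    qed
  qed
  finally show ?thesis
    unfolding A_mat_quadratic_form[OF r] v_def .
qed

theorem corollary5p3:
  fixes n :: nat
    and b c :: "nat \<Rightarrow> real"
    and \<alpha> \<gamma> a0 r0 :: real
    and a r f :: "real \<Rightarrow> real"
  assumes "n \<ge> 1"
    and "b 0 = 0" and "b (n + 1) = 1" and "\<And>i. i \<le> n \<Longrightarrow> b i < b (i + 1)"
    and "\<gamma> > 0"
    and "L_infinity I01 a" and "L_infinity I01 r"
    and "a0 > 0" and "AE x in lebesgue_on I01. a x \<ge> a0"
    and "r0 \<ge> 0" and "AE x in lebesgue_on I01. r x \<ge> r0"
    and "\<And>i. i \<in> {1..n} \<Longrightarrow> c i \<noteq> 0"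
    and "\<And>i. i \<in> {1..n} \<Longrightarrow> a differentiable (at (b i))"
    and "\<And>i. i \<in> {1..n} \<Longrightarrow>
           g_coeff n a r f \<alpha> c b i / c i + r0 * min_mesh_width b i / 4 > 0"
  shows "invertible_mat (H_mat n a r f \<gamma> \<alpha> c b)"
proof (rule invertible_mat_if_trivial_kernel)
  show "H_mat n a r f \<gamma> \<alpha> c b \<in> carrier_mat n n"
    by (simp add: H_mat_eq)
next
  fix v assume v: "v \<in> carrier_vec n" and ker: "H_mat n a r f \<gamma> \<alpha> c b *\<^sub>v v = 0\<^sub>v n"
  define \<eta> where "\<eta> i = c (Suc i) * v $ i" for i
  define G where "G i = g_coeff n a r f \<alpha> c b (Suc i) / c (Suc i)" for i
  let ?m = "\<lambda>i. min_mesh_width b (Suc i)"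
  have c: "c (Suc i) \<noteq> 0" if "i < n" for i
    using assms(12) that by simp
  have pos: "G i + r0 * ?m i / 4 > 0" if "i < n" for i
    using assms(14)[of "Suc i"] that by (simp add: G_def)
  \<comment> \<open>Row i of the kernel equation, divided by \<open>c (Suc i)\<close>; dividing the
    diagonal entry by this coefficient as well turns \<open>v $ i\<close> into
    \<open>\<eta> i\<close>.\<close>
  have row: "G i * \<eta> i + (\<Sum>j<n. A_mat n r b $$ (i, j) * \<eta> j) + \<gamma> * (\<Sum>j<n. \<eta> j) = 0"
    if "i < n" for i
    using H_mat_mult_vec[OF v that, of a r f \<gamma> \<alpha> c b] c[OF that] that
    by (simp add: ker \<eta>_def G_def)
  \<comment> \<open>Pairing the rows with \<open>\<eta>\<close> itself yields the quadratic
    form.\<close>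
  have "0 = (\<Sum>i<n. \<eta> i *
      (G i * \<eta> i + (\<Sum>j<n. A_mat n r b $$ (i, j) * \<eta> j) + \<gamma> * (\<Sum>j<n. \<eta> j)))"
    using row by simp
  also have "\<dots> = (\<Sum>i<n. G i * (\<eta> i)\<^sup>2)
      + (\<Sum>i<n. \<Sum>j<n. \<eta> i * (A_mat n r b $$ (i, j) * \<eta> j)) + \<gamma> * (\<Sum>i<n. \<eta> i)\<^sup>2"
    by (simp add: algebra_simps sum.distrib sum_distrib_left sum_distrib_right power2_eq_square)
  \<comment> \<open>The rank-one term is \<open>\<gamma>\<close> times a square and is bounded below
    by 0.\<close>
  also have "\<dots> \<ge> (\<Sum>i<n. G i * (\<eta> i)\<^sup>2) + r0 / 4 * (\<Sum>i<n. ?m i * (\<eta> i)\<^sup>2) + 0"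
    using assms(2-5)
    by (intro add_mono order_refl A_mat_quadratic_form_ge assms(7,10,11)) (auto simp: less_imp_le)
  finally have le: "(\<Sum>i<n. (G i + r0 * ?m i / 4) * (\<eta> i)\<^sup>2) \<le> 0"
    by (simp add: algebra_simps sum.distrib sum_distrib_left)
  have nonneg: "0 \<le> (G i + r0 * ?m i / 4) * (\<eta> i)\<^sup>2" if "i \<in> {..<n}" for i
    using pos[of i] that by (intro mult_nonneg_nonneg) auto
  \<comment> \<open>By the main hypothesis all weights are positive, so a nonpositive sum of these
    squares forces every \<open>\<eta> i\<close> to vanish, and c \<noteq> 0 carries this back to
    \<open>v\<close>.\<close>
  have "(\<Sum>i<n. (G i + r0 * ?m i / 4) * (\<eta> i)\<^sup>2) = 0"
    using le sum_nonneg[of "{..<n}", OF nonneg] by (rule order_antisym)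
  then have "\<forall>i\<in>{..<n}. (G i + r0 * ?m i / 4) * (\<eta> i)\<^sup>2 = 0"
    by (subst (asm) sum_nonneg_eq_0_iff) (use nonneg in auto)
  then have "\<eta> i = 0" if "i < n" for i
    using pos[OF that] that by (metis lessThan_iff less_irrefl mult_eq_0_iff power_eq_0_iff)
  then show "v = 0\<^sub>v n"
    using v c by (intro eq_vecI) (auto simp: \<eta>_def)
qed

end
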